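(* Let $D$ be a PVMD. Then the complete integral closure $D''$ of $D$ is the generalized ring of fractions $D_S$, where $$S=\Big\{\,I \;\Big|\; I\subseteq D \text{ is a } t\text{-invertible ideal and } \bigcap_{n=1}^{\infty}(I^n)_v\ne(0)\,\Big\}$$ is a multiplicative system of ideals.
   Context: $D$ is an integral domain with quotient field $K$. For a nonzero fractional ideal $I$ put $I^{-1}=\{x\in K\mid xI\subseteq D\}$, $I_v=(I^{-1})^{-1}$, and $I_t=\bigcup\{J_v\mid J\subseteq I,\ J \text{ a nonzero finitely generated fractional ideal}\}$. $I$ is $t$-invertible if $(II^{-1})_t=D$. $D$ is a PVMD (Prüfer $v$-multiplication domain) if every nonzero finitely generated ideal of $D$ is $t$-invertible. The complete integral closure of $D$ is $D''=\{x\in K\mid \text{there is } 0\ne r\in D \text{ with } rx^n\in D \text{ for all } n\ge 1\}$. A multiplicative system of ideals is a nonempty family $S$ of nonzero ideals of $D$ with $IJ\in S$ for all $I,J\in S$; the generalized ring of fractions of $D$ with respect to $S$ is $D_S=\bigcup\{(D:_KJ)\mid J\in S\}$, where $(D:_KJ)=\{x\in K\mid xJ\subseteq D\}$. *)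

theory Defs
  imports "HOL-Computational_Algebra.Polynomial_Factorial"
begin

text \<open>
  The domain $D$ is the type \<open>'a :: idom\<close>, and its quotient field $K$ is \<open>'a fract\<close>.
  All ideals, fractional or integral, are subsets of $K$; hence $D$ appears as the
  subset \<open>dom_set\<close> of $K$.
\<close>

definition dom_set :: "'a::idom fract set"
  where "dom_set = range to_fract"

definition fract_scale :: "'a::idom \<Rightarrow> 'a fract \<Rightarrow> 'a fract"
  where "fract_scale d x = to_fract d * x"

global_interpretation fract_mod: module "fract_scale :: 'a::idom \<Rightarrow> 'a fract \<Rightarrow> 'a fract"
  by unfold_locales (simp_all add: fract_scale_def algebra_simps)

definition fractional_ideal :: "'a::idom fract set \<Rightarrow> bool"
  where "fractional_ideal I \<longleftrightarrow>
    fract_mod.subspace I \<and> (\<exists>d::'a. d \<noteq> 0 \<and> (\<forall>x\<in>I. to_fract d * x \<in> dom_set))"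

definition nonzero_fractional_ideal :: "'a::idom fract set \<Rightarrow> bool"
  where "nonzero_fractional_ideal I \<longleftrightarrow> fractional_ideal I \<and> I \<noteq> {0}"

definition ideal_of_dom :: "'a::idom fract set \<Rightarrow> bool"
  where "ideal_of_dom I \<longleftrightarrow> fract_mod.subspace I \<and> I \<subseteq> dom_set"

definition fin_gen :: "'a::idom fract set \<Rightarrow> bool"
  where "fin_gen I \<longleftrightarrow> (\<exists>F. finite F \<and> I = fract_mod.span F)"

definition ideal_mult :: "'a::idom fract set \<Rightarrow> 'a fract set \<Rightarrow> 'a fract set"
  where "ideal_mult I J = fract_mod.span {x * y |x y. x \<in> I \<and> y \<in> J}"

primrec ideal_pow :: "'a::idom fract set \<Rightarrow> nat \<Rightarrow> 'a fract set"
  where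
    "ideal_pow I 0 = dom_set"
  | "ideal_pow I (Suc n) = ideal_mult I (ideal_pow I n)"

text \<open>$(D :_K J)$, which for a nonzero fractional ideal $J$ is also $J^{-1}$.\<close>

definition dom_colon :: "'a::idom fract set \<Rightarrow> 'a fract set"
  where "dom_colon J = {x. \<forall>y\<in>J. x * y \<in> dom_set}"

definition v_closure :: "'a::idom fract set \<Rightarrow> 'a fract set"
  where "v_closure I = dom_colon (dom_colon I)"

definition t_closure :: "'a::idom fract set \<Rightarrow> 'a fract set"
  where "t_closure I =
    \<Union>{v_closure J |J. J \<subseteq> I \<and> nonzero_fractional_ideal J \<and> fin_gen J}"

definition t_invertible :: "'a::idom fract set \<Rightarrow> bool"
  where "t_invertible I \<longleftrightarrow>
    nonzero_fractional_ideal I \<and> t_closure (ideal_mult I (dom_colon I)) = dom_set"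

definition pvmd :: "'a::idom itself \<Rightarrow> bool"
  where "pvmd _ \<longleftrightarrow>
    (\<forall>I :: 'a fract set. ideal_of_dom I \<and> I \<noteq> {0} \<and> fin_gen I \<longrightarrow> t_invertible I)"

definition complete_integral_closure :: "'a::idom fract set"
  where "complete_integral_closure =
    {x. \<exists>r::'a. r \<noteq> 0 \<and> (\<forall>n\<ge>1. to_fract r * x ^ n \<in> dom_set)}"

definition multiplicative_system :: "'a::idom fract set set \<Rightarrow> bool"
  where "multiplicative_system S \<longleftrightarrow>
    S \<noteq> {} \<and> (\<forall>I\<in>S. ideal_of_dom I \<and> I \<noteq> {0}) \<and> (\<forall>I\<in>S. \<forall>J\<in>S. ideal_mult I J \<in> S)"

definition gen_ring_of_fractions :: "'a::idom fract set set \<Rightarrow> 'a fract set"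
  where "gen_ring_of_fractions S = (\<Union>J\<in>S. dom_colon J)"

end

theory Submission
  imports Defs
begin

text \<open>
  An element \<open>x\<close> of $D''$ with $r x^n \in D$ lies in $(D :_K I)$ for $I = (1,x)^{-1}$, which the
  PVMD hypothesis makes $t$-invertible. A $t$-invertible ideal satisfies $(I :_K I) = D$; as
  $I = \{z \mid z, zx \in D\}$, an induction on $n$ shows that $w \in D$ whenever
  $w x^k I^n \subseteq D$ for all $k \le n$. With $w = ry$, where $y I^n \subseteq D$, this
  gives $r \in (I^n)_v$ for all $n$. Conversely, $xJ \subseteq D$ implies
  $x^n (J^n)_v \subseteq D$, so any nonzero \<open>r\<close> in $\bigcap_n (J^n)_v$ witnesses
  $x \in D''$.
\<close>

section \<open>Submodules of K: products and powers of ideals\<close>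

lemma subspace_dom_set: "fract_mod.subspace (dom_set :: 'a::idom fract set)"
proof -
  have "to_fract a + to_fract b \<in> (dom_set :: 'a fract set)"
    and "to_fract a * to_fract b \<in> (dom_set :: 'a fract set)" for a b :: 'a
    unfolding dom_set_def by (metis rangeI to_fract_add, metis rangeI to_fract_mult)
  moreover have "(0 :: 'a fract) \<in> dom_set"
    unfolding dom_set_def by (metis rangeI to_fract_0)
  ultimately show ?thesis
    by (auto simp: fract_mod.subspace_def fract_scale_def dom_set_def)
qed

lemma one_in_dom_set [simp]: "(1 :: 'a::idom fract) \<in> dom_set"
  unfolding dom_set_def by (metis rangeI to_fract_1)

lemma to_fract_in_dom_set [simp]: "to_fract d \<in> dom_set"
  by (simp add: dom_set_def)

lemma dom_set_mult: "x \<in> dom_set \<Longrightarrow> y \<in> dom_set \<Longrightarrow> x * y \<in> dom_set"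
  by (auto simp: dom_set_def simp flip: to_fract_mult)

text \<open>Multiplication by \<open>x\<close> is D-linear. With \<open>span_minimal\<close>, this
  reduces a condition of the form xN \<subseteq> M to generators of N.\<close>

lemma subspace_mult_preimage:
  assumes "fract_mod.subspace M"
  shows "fract_mod.subspace {y. x * y \<in> M}"
proof (rule fract_mod.subspaceI)
  show "0 \<in> {y. x * y \<in> M}"
    using fract_mod.subspace_0[OF assms] by simp
  show "y + z \<in> {y. x * y \<in> M}" if "y \<in> {y. x * y \<in> M}" "z \<in> {y. x * y \<in> M}" for y z
    using that fract_mod.subspace_add[OF assms, of "x * y" "x * z"] by (simp add: distrib_left)
  show "fract_scale c y \<in> {y. x * y \<in> M}" if "y \<in> {y. x * y \<in> M}" for c y
    using that fract_mod.subspace_scale[OF assms, of "x * y" c]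
    by (simp add: fract_scale_def mult.left_commute)
qed

lemma span_subset_dom_set: "X \<subseteq> dom_set \<Longrightarrow> fract_mod.span X \<subseteq> dom_set"
  by (rule fract_mod.span_minimal[OF _ subspace_dom_set])

text \<open>Bilinearity, one factor at a time: first an element of \<open>X\<close> is fixed and the
  other factor extended to the span of \<open>Y\<close>, then that factor is fixed and the first one
  extended.\<close>

lemma span_mult_mem:
  assumes M: "fract_mod.subspace M"
    and XY: "\<And>x y. x \<in> X \<Longrightarrow> y \<in> Y \<Longrightarrow> x * y \<in> M"
    and x: "x \<in> fract_mod.span X" and y: "y \<in> fract_mod.span Y"
  shows "x * y \<in> M"
proof -
  have "fract_mod.span Y \<subseteq> {y. a * y \<in> M}" if "a \<in> X" for a
    using XY that by (intro fract_mod.span_minimal subspace_mult_preimage M) auto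
  then have "fract_mod.span X \<subseteq> {x. y * x \<in> M}"
    using y by (intro fract_mod.span_minimal subspace_mult_preimage M) (auto simp: mult.commute)
  then show ?thesis
    using x by (auto simp: mult.commute)
qed

lemma subspace_ideal_mult: "fract_mod.subspace (ideal_mult I J)"
  by (simp add: ideal_mult_def)

lemma ideal_mult_mem: "x \<in> I \<Longrightarrow> y \<in> J \<Longrightarrow> x * y \<in> ideal_mult I J"
  unfolding ideal_mult_def by (rule fract_mod.span_base) blast

lemma ideal_mult_subset:
  assumes "fract_mod.subspace M" "\<And>x y. x \<in> I \<Longrightarrow> y \<in> J \<Longrightarrow> x * y \<in> M"
  shows "ideal_mult I J \<subseteq> M"
  unfolding ideal_mult_def using assms by (intro fract_mod.span_minimal) auto

lemma ideal_of_dom_mult: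
  assumes "ideal_of_dom I" "ideal_of_dom J"
  shows "ideal_of_dom (ideal_mult I J)"
proof -
  have "ideal_mult I J \<subseteq> dom_set"
    using assms by (intro ideal_mult_subset subspace_dom_set dom_set_mult)
      (auto simp: ideal_of_dom_def)
  then show ?thesis
    by (simp add: ideal_of_dom_def subspace_ideal_mult)
qed

lemma subspace_nonzeroE:
  assumes "fract_mod.subspace I" "I \<noteq> {0}"
  obtains x where "x \<in> I" "x \<noteq> 0"
  using assms fract_mod.subspace_0 by blast

lemma ideal_mult_nonzero:
  assumes "fract_mod.subspace I" "I \<noteq> {0}" "fract_mod.subspace J" "J \<noteq> {0}"
  shows "ideal_mult I J \<noteq> {0}"
proof -
  obtain x where "x \<in> I" "x \<noteq> 0"
    using assms(1,2) by (rule subspace_nonzeroE)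
  moreover obtain y where "y \<in> J" "y \<noteq> 0"
    using assms(3,4) by (rule subspace_nonzeroE)
  ultimately have "x * y \<in> ideal_mult I J" "x * y \<noteq> 0"
    by (simp_all add: ideal_mult_mem)
  then show ?thesis
    by blast
qed

lemma ideal_pow_Suc_mem: "x \<in> I \<Longrightarrow> y \<in> ideal_pow I n \<Longrightarrow> x * y \<in> ideal_pow I (Suc n)"
  by (simp add: ideal_mult_mem)

lemma ideal_pow_subset_dom_set:
  assumes "I \<subseteq> dom_set"
  shows "ideal_pow I n \<subseteq> dom_set"
proof (induction n)
  case (Suc n)
  show ?case
    unfolding ideal_pow.simps(2)
    using assms Suc by (intro ideal_mult_subset subspace_dom_set dom_set_mult) auto
qed simp

lemma nonzero_fractional_idealI:
  assumes "ideal_of_dom I" "I \<noteq> {0}"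
  shows "nonzero_fractional_ideal I"
  using assms by (auto simp: nonzero_fractional_ideal_def fractional_ideal_def ideal_of_dom_def
      subset_iff intro!: exI[of _ 1])

lemma ideal_of_dom_dom_set: "ideal_of_dom dom_set"
  by (simp add: ideal_of_dom_def subspace_dom_set)

lemma dom_set_nonzero: "dom_set \<noteq> {0 :: 'a::idom fract}"
  by (metis one_in_dom_set singletonD zero_neq_one)

section \<open>The colon operation (D : J) and its behaviour on products\<close>

lemma dom_colonD: "x \<in> dom_colon J \<Longrightarrow> y \<in> J \<Longrightarrow> x * y \<in> dom_set"
  by (simp add: dom_colon_def)

lemma subspace_dom_colon: "fract_mod.subspace (dom_colon J)"
proof -
  have "dom_colon J = (\<Inter>y\<in>J. {x. y * x \<in> dom_set})"
    by (auto simp: dom_colon_def mult.commute)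
  then show ?thesis
    by (auto intro!: fract_mod.subspace_Inter subspace_mult_preimage subspace_dom_set)
qed

lemma dom_colon_antimono: "I \<subseteq> J \<Longrightarrow> dom_colon J \<subseteq> dom_colon I"
  by (auto simp: dom_colon_def)

text \<open>Allows a finite generating set to take the place of the ideal it generates in every
  colon computed later.\<close>

lemma dom_colon_span [simp]: "dom_colon (fract_mod.span X) = dom_colon X"
proof
  show "dom_colon (fract_mod.span X) \<subseteq> dom_colon X"
    by (intro dom_colon_antimono fract_mod.span_superset)
  show "dom_colon X \<subseteq> dom_colon (fract_mod.span X)"
  proof
    fix x assume "x \<in> dom_colon X"
    then have "fract_mod.span X \<subseteq> {y. x * y \<in> dom_set}"
      by (intro fract_mod.span_minimal subspace_mult_preimage subspace_dom_set)
        (auto dest: dom_colonD)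
    then show "x \<in> dom_colon (fract_mod.span X)"
      by (auto simp: dom_colon_def)
  qed
qed

lemma dom_colon_dom_set [simp]: "dom_colon dom_set = dom_set"
proof
  show "dom_colon dom_set \<subseteq> dom_set"
    using dom_colonD[OF _ one_in_dom_set] by auto
  show "dom_set \<subseteq> dom_colon dom_set"
    by (auto simp: dom_colon_def intro: dom_set_mult)
qed

lemma dom_colon_ideal_mult:
  "x \<in> dom_colon (ideal_mult I J) \<longleftrightarrow> (\<forall>a\<in>I. \<forall>b\<in>J. x * (a * b) \<in> dom_set)"
  by (auto simp: ideal_mult_def) (auto simp: dom_colon_def)

text \<open>Stands in for (IJ)^n = I^n J^n, seen only through its colon. All membership conditions
  are tested on products of elements, so the identity becomes a reordering of factors in the field
  K.\<close>

lemma dom_colon_ideal_pow_mult: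
  "x \<in> dom_colon (ideal_pow (ideal_mult I J) n) \<longleftrightarrow>
    (\<forall>p\<in>ideal_pow I n. \<forall>q\<in>ideal_pow J n. x * (p * q) \<in> dom_set)"
proof (induction n arbitrary: x)
  case 0
  \<comment> \<open>Both powers are D: testing p = q = 1 gives x \<in> D, and closure of D under
    products gives the converse.\<close>
  show ?case
    by (auto intro: dom_set_mult dest!: bspec[OF _ one_in_dom_set])
next
  case (Suc n)
  have "x \<in> dom_colon (ideal_pow (ideal_mult I J) (Suc n)) \<longleftrightarrow>
      (\<forall>c\<in>ideal_mult I J. x * c \<in> dom_colon (ideal_pow (ideal_mult I J) n))"
    by (simp add: dom_colon_ideal_mult) (simp add: dom_colon_def mult.assoc)
  \<comment> \<open>The induction hypothesis is used at \<open>x * c\<close>, hence the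
    generalization over \<open>x\<close>.\<close>
  also have "\<dots> \<longleftrightarrow> (\<forall>c\<in>ideal_mult I J. \<forall>p\<in>ideal_pow I n. \<forall>q\<in>ideal_pow J n.
      x * (p * q) * c \<in> dom_set)"
    unfolding Suc by (simp add: mult_ac)
  also have "\<dots> \<longleftrightarrow> (\<forall>p\<in>ideal_pow I n. \<forall>q\<in>ideal_pow J n. x * (p * q) \<in> dom_colon (ideal_mult I J))"
    unfolding dom_colon_def by blast
  also have "\<dots> \<longleftrightarrow> (\<forall>p\<in>ideal_pow I n. \<forall>q\<in>ideal_pow J n. \<forall>a\<in>I. \<forall>b\<in>J.
      x * (a * p) * (b * q) \<in> dom_set)"
    by (simp add: dom_colon_ideal_mult mult_ac)
  \<comment> \<open>The factors are now regrouped: \<open>b * q\<close> runs over the generators of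
    \<open>ideal_pow J (Suc n)\<close>, and later \<open>a * p\<close> over those of
    \<open>ideal_pow I (Suc n)\<close>.\<close>
  also have "\<dots> \<longleftrightarrow> (\<forall>a\<in>I. \<forall>p\<in>ideal_pow I n. x * (a * p) \<in> dom_colon (ideal_pow J (Suc n)))"
    unfolding ideal_pow.simps(2)[of J] dom_colon_ideal_mult by blast
  also have "\<dots> \<longleftrightarrow> (\<forall>a\<in>I. \<forall>p\<in>ideal_pow I n. \<forall>q\<in>ideal_pow J (Suc n).
      x * q * (a * p) \<in> dom_set)"
    unfolding dom_colon_def mem_Collect_eq by (simp only: mult_ac)
  also have "\<dots> \<longleftrightarrow> (\<forall>q\<in>ideal_pow J (Suc n). x * q \<in> dom_colon (ideal_pow I (Suc n)))"
    unfolding ideal_pow.simps(2)[of I] dom_colon_ideal_mult by blast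
  also have "\<dots> \<longleftrightarrow> (\<forall>q\<in>ideal_pow J (Suc n). \<forall>p\<in>ideal_pow I (Suc n). x * (p * q) \<in> dom_set)"
    unfolding dom_colon_def mem_Collect_eq by (simp only: mult_ac)
  finally show ?case
    by blast
qed

lemma power_in_dom_colon_ideal_pow:
  assumes "x \<in> dom_colon J"
  shows "x ^ n \<in> dom_colon (ideal_pow J n)"
proof (induction n)
  case (Suc n)
  show ?case
    unfolding ideal_pow.simps(2) dom_colon_ideal_mult
  proof (intro ballI)
    fix a b assume "a \<in> J" "b \<in> ideal_pow J n"
    then have "(x * a) * (x ^ n * b) \<in> dom_set"
      using assms Suc by (intro dom_set_mult dom_colonD)
    then show "x ^ Suc n * (a * b) \<in> dom_set"
      by (simp add: mult_ac)
  qed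
qed simp

section \<open>The v-closure of ideals and of their powers\<close>

lemma v_closureD: "x \<in> v_closure I \<Longrightarrow> y \<in> dom_colon I \<Longrightarrow> x * y \<in> dom_set"
  unfolding v_closure_def by (rule dom_colonD)

lemma v_closureI: "(\<And>y. y \<in> dom_colon I \<Longrightarrow> x * y \<in> dom_set) \<Longrightarrow> x \<in> v_closure I"
  by (simp add: v_closure_def dom_colon_def)

lemma v_closure_subset_dom_set:
  assumes "I \<subseteq> dom_set"
  shows "v_closure I \<subseteq> dom_set"
  using dom_colon_antimono[OF dom_colon_antimono[OF assms]] by (simp add: v_closure_def)

text \<open>If y(IJ)^n \<subseteq> D, then yp lies in (D : J^n) for each p in I^n, so b(yp) \<in> D.
  Thus by lies in (D : I^n), and a(by) \<in> D. This is what makes the intersection condition in S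
  stable under products.\<close>

lemma v_closure_ideal_pow_mult:
  assumes a: "a \<in> v_closure (ideal_pow I n)" and b: "b \<in> v_closure (ideal_pow J n)"
  shows "a * b \<in> v_closure (ideal_pow (ideal_mult I J) n)"
proof (rule v_closureI)
  fix y assume "y \<in> dom_colon (ideal_pow (ideal_mult I J) n)"
  then have "y * p \<in> dom_colon (ideal_pow J n)" if "p \<in> ideal_pow I n" for p
    using that by (simp add: dom_colon_ideal_pow_mult) (simp add: dom_colon_def mult.assoc)
  then have "b * (y * p) \<in> dom_set" if "p \<in> ideal_pow I n" for p
    using that v_closureD[OF b] by blast
  then have "b * y \<in> dom_colon (ideal_pow I n)"
    by (simp add: dom_colon_def mult.assoc)
  then show "a * b * y \<in> dom_set"
    using v_closureD[OF a] by (simp add: mult.assoc)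
qed

section \<open>The t-closure and t-invertible ideals\<close>

lemma ideal_mult_dom_colon_subset: "ideal_mult I (dom_colon I) \<subseteq> dom_set"
  by (rule ideal_mult_subset[OF subspace_dom_set]) (metis dom_colonD mult.commute)

text \<open>Since A is integral, its t-closure lies in D and equals D as soon as it contains 1. Now
  1 \<in> J_v means (D : J) \<subseteq> D, which depends only on a finite generating set F of J; a
  nonzero f in F makes J nonzero.\<close>

lemma t_closure_eq_dom_set_iff:
  assumes A: "ideal_of_dom A"
  shows "t_closure A = dom_set \<longleftrightarrow>
    (\<exists>F. finite F \<and> F \<subseteq> A \<and> (\<exists>f\<in>F. f \<noteq> 0) \<and> dom_colon F \<subseteq> dom_set)"
    (is "_ \<longleftrightarrow> (\<exists>F. ?good F)")
proof
  assume "t_closure A = dom_set"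
  then have "1 \<in> t_closure A"
    by simp
  then obtain F where F: "finite F" "fract_mod.span F \<subseteq> A" "fract_mod.span F \<noteq> {0}"
    and "1 \<in> v_closure (fract_mod.span F)"
    by (auto simp: t_closure_def fin_gen_def nonzero_fractional_ideal_def)
  then have "dom_colon F \<subseteq> dom_set"
    using v_closureD[of 1] by fastforce
  moreover have "\<exists>f\<in>F. f \<noteq> 0"
  proof (rule ccontr)
    assume "\<not> (\<exists>f\<in>F. f \<noteq> 0)"
    then have "fract_mod.span F \<subseteq> {0}"
      by (intro fract_mod.span_minimal fract_mod.subspace_single_0) auto
    then show False
      using F(3) fract_mod.span_zero by blast
  qed
  ultimately show "\<exists>F. ?good F"
    using F fract_mod.span_superset by blast
next
  assume "\<exists>F. ?good F"
  then obtain F f where F: "finite F" "F \<subseteq> A" "dom_colon F \<subseteq> dom_set" and f: "f \<in> F" "f \<noteq> 0"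
    by blast
  let ?J = "fract_mod.span F"
  have JA: "?J \<subseteq> A"
    using A F(2) by (simp add: ideal_of_dom_def fract_mod.span_minimal)
  have "?J \<noteq> {0}"
    using f fract_mod.span_base by blast
  then have J: "nonzero_fractional_ideal ?J"
    using JA A by (intro nonzero_fractional_idealI) (auto simp: ideal_of_dom_def)
  have "dom_set \<subseteq> v_closure ?J"
    using F(3) by (auto intro!: v_closureI dom_set_mult)
  then have "dom_set \<subseteq> t_closure A"
    using F(1) J JA unfolding t_closure_def fin_gen_def by blast
  moreover have "v_closure J \<subseteq> dom_set" if "J \<subseteq> A" for J
    using A that by (intro v_closure_subset_dom_set) (auto simp: ideal_of_dom_def)
  then have "t_closure A \<subseteq> dom_set"
    unfolding t_closure_def by blast
  ultimately show "t_closure A = dom_set"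
    by blast
qed

lemma t_invertible_iff:
  assumes "ideal_of_dom I" "I \<noteq> {0}"
  shows "t_invertible I \<longleftrightarrow>
    (\<exists>F. finite F \<and> F \<subseteq> ideal_mult I (dom_colon I) \<and> (\<exists>f\<in>F. f \<noteq> 0) \<and> dom_colon F \<subseteq> dom_set)"
proof -
  have "ideal_of_dom (ideal_mult I (dom_colon I))"
    by (simp add: ideal_of_dom_def subspace_ideal_mult ideal_mult_dom_colon_subset)
  then show ?thesis
    using nonzero_fractional_idealI[OF assms] by (simp add: t_invertible_def t_closure_eq_dom_set_iff)
qed

lemma t_invertible_dom_set: "t_invertible dom_set"
proof -
  \<comment> \<open>The witness is {1}: 1 lies in D D^{-1}, and (D : {1}) = D.\<close>
  have "1 * 1 \<in> ideal_mult dom_set (dom_set :: 'a fract set)"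
    by (intro ideal_mult_mem one_in_dom_set)
  moreover have "dom_colon {1 :: 'a fract} \<subseteq> dom_set"
    by (auto simp: dom_colon_def)
  ultimately show ?thesis
    unfolding t_invertible_iff[OF ideal_of_dom_dom_set dom_set_nonzero]
    by (intro exI[of _ "{1}"]) simp
qed

text \<open>The pairwise products of witnesses \<open>F\<close> for I and \<open>G\<close> for J
  form a witness for IJ, because (I I^{-1})(J J^{-1}) \<subseteq> (IJ)(IJ)^{-1}.\<close>

lemma t_invertible_mult:
  assumes I: "ideal_of_dom I" "t_invertible I" and J: "ideal_of_dom J" "t_invertible J"
  shows "t_invertible (ideal_mult I J)"
proof -
  have I0: "I \<noteq> {0}" and J0: "J \<noteq> {0}"
    using I(2) J(2) by (auto simp: t_invertible_def nonzero_fractional_ideal_def)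
  obtain F f where F: "finite F" "F \<subseteq> ideal_mult I (dom_colon I)" "f \<in> F" "f \<noteq> 0"
      "dom_colon F \<subseteq> dom_set"
    using t_invertible_iff[OF I(1) I0] I(2) by blast
  obtain G g where G: "finite G" "G \<subseteq> ideal_mult J (dom_colon J)" "g \<in> G" "g \<noteq> 0"
      "dom_colon G \<subseteq> dom_set"
    using t_invertible_iff[OF J(1) J0] J(2) by blast
  let ?H = "(\<lambda>(f, g). f * g) ` (F \<times> G)"
  let ?IJ = "ideal_mult I J"
  have "(a * b) * (c * d) \<in> ideal_mult ?IJ (dom_colon ?IJ)"
    if "a \<in> I" "b \<in> dom_colon I" "c \<in> J" "d \<in> dom_colon J" for a b c d
  proof -
    have "b * d * (u * w) \<in> dom_set" if "u \<in> I" "w \<in> J" for u w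
      using dom_set_mult[OF dom_colonD[of b I u] dom_colonD[of d J w]] that
        \<open>b \<in> dom_colon I\<close> \<open>d \<in> dom_colon J\<close> by (simp add: mult_ac)
    then have "b * d \<in> dom_colon ?IJ"
      by (simp add: dom_colon_ideal_mult)
    then have "(a * c) * (b * d) \<in> ideal_mult ?IJ (dom_colon ?IJ)"
      using that by (intro ideal_mult_mem)
    then show ?thesis
      by (simp add: mult_ac)
  qed
  \<comment> \<open>The preceding claim treats generators of the two ideals; bilinearity extends it
    to all their elements.\<close>
  then have "u * w \<in> ideal_mult ?IJ (dom_colon ?IJ)"
    if "u \<in> ideal_mult I (dom_colon I)" "w \<in> ideal_mult J (dom_colon J)" for u w
    using that unfolding ideal_mult_def[of I "dom_colon I"] ideal_mult_def[of J "dom_colon J"]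
    by (elim span_mult_mem[OF subspace_ideal_mult, rotated]) auto
  then have "?H \<subseteq> ideal_mult ?IJ (dom_colon ?IJ)"
    using F(2) G(2) by auto
  moreover have "dom_colon ?H \<subseteq> dom_set"
  proof
    fix x assume x: "x \<in> dom_colon ?H"
    \<comment> \<open>The colon is taken in two stages: x u g \<in> D for all g in \<open>G\<close>
      puts x u in (D : G) \<subseteq> D, for every u in \<open>F\<close>, and so x in (D :
      F).\<close>
    have "x * u \<in> dom_colon G" if "u \<in> F" for u
      using x that by (auto simp: dom_colon_def mult.assoc)
    then have "x \<in> dom_colon F"
      using G(5) by (auto simp: dom_colon_def[of F])
    then show "x \<in> dom_set"
      using F(5) by blast
  qed
  moreover have "\<exists>h\<in>?H. h \<noteq> 0"
    using F(3,4) G(3,4) by (intro bexI[of _ "f * g"]) auto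
  moreover have "?IJ \<noteq> {0}"
    using I(1) I0 J(1) J0 by (intro ideal_mult_nonzero) (auto simp: ideal_of_dom_def)
  ultimately show ?thesis
    using F(1) G(1) ideal_of_dom_mult[OF I(1) J(1)] t_invertible_iff[of ?IJ]
    by (metis finite_SigmaI finite_imageI)
qed

text \<open>From zI \<subseteq> I follows z(I I^{-1}) \<subseteq> D. Hence z \<in> (D : F) for the
  finite set F \<subseteq> I I^{-1} given by t-invertibility, and this colon lies in D.\<close>

lemma t_invertible_stable_multiplier:
  assumes I: "ideal_of_dom I" "t_invertible I" and z: "\<And>i. i \<in> I \<Longrightarrow> z * i \<in> I"
  shows "z \<in> dom_set"
proof -
  have I0: "I \<noteq> {0}"
    using I(2) by (auto simp: t_invertible_def nonzero_fractional_ideal_def)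
  obtain F where F: "F \<subseteq> ideal_mult I (dom_colon I)" "dom_colon F \<subseteq> dom_set"
    using t_invertible_iff[OF I(1) I0] I(2) by blast
  have "z * (i * q) \<in> dom_set" if "i \<in> I" "q \<in> dom_colon I" for i q
    using dom_colonD[OF that(2) z[OF that(1)]] by (simp add: mult_ac)
  then have "z \<in> dom_colon (ideal_mult I (dom_colon I))"
    by (simp add: dom_colon_ideal_mult)
  then show ?thesis
    using F dom_colon_antimono by blast
qed

section \<open>The ideal (1,x)^{-1} and its powers\<close>

lemma dom_colon_pair: "z \<in> dom_colon {1, x} \<longleftrightarrow> z \<in> dom_set \<and> z * x \<in> dom_set"
  by (simp add: dom_colon_def)

lemma ideal_of_dom_dom_colon_pair: "ideal_of_dom (dom_colon {1, x})"
  by (auto simp: ideal_of_dom_def subspace_dom_colon dom_colon_pair)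

lemma fract_denominator:
  obtains a b where "b \<noteq> 0" "x * to_fract b = to_fract a"
proof (cases x rule: Fract_cases)
  case (Fract a b)
  then have "x * to_fract b = to_fract a"
    by (simp add: Fract_conv_to_fract)
  then show ?thesis
    using that Fract by blast
qed

text \<open>With x = a/b, the ideal B = (b,a) = b(1,x) is integral and finitely generated, so the
  hypothesis applies to it. Its witness \<open>F\<close> carries over to I = (1,x)^{-1} since B
  B^{-1} \<subseteq> I I^{-1}: a product pq is rewritten as (qb)(p/b).\<close>

lemma pvmd_t_invertible_dom_colon_pair:
  fixes x :: "'a::idom fract"
  assumes "pvmd TYPE('a)"
  shows "t_invertible (dom_colon {1, x})"
proof -
  obtain a b where b: "b \<noteq> 0" and ab: "x * to_fract b = to_fract a"
    by (rule fract_denominator)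
  let ?I = "dom_colon {1, x}"
  let ?X = "{to_fract b, to_fract a}"
  let ?B = "fract_mod.span ?X"
  have bI: "to_fract b \<in> ?I"
    using ab by (simp add: dom_colon_pair mult.commute)
  then have I0: "?I \<noteq> {0}"
    using b by auto
  have B: "ideal_of_dom ?B"
    using span_subset_dom_set[of ?X] by (simp add: ideal_of_dom_def)
  have "to_fract b \<in> ?B"
    by (simp add: fract_mod.span_base)
  then have B0: "?B \<noteq> {0}"
    using b by auto
  have "fin_gen ?B"
    unfolding fin_gen_def by (intro exI[of _ ?X]) simp
  then have "t_invertible ?B"
    using assms B B0 unfolding pvmd_def by blast
  then obtain F where F: "finite F" "F \<subseteq> ideal_mult ?B (dom_colon ?B)" "\<exists>f\<in>F. f \<noteq> 0"
      "dom_colon F \<subseteq> dom_set"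
    unfolding t_invertible_iff[OF B B0] by blast
  have "ideal_mult ?B (dom_colon ?B) \<subseteq> ideal_mult ?I (dom_colon ?I)"
  proof (rule ideal_mult_subset[OF subspace_ideal_mult])
    fix p q assume p: "p \<in> ?B" and q: "q \<in> dom_colon ?B"
    have "q * to_fract b \<in> ?I"
    proof -
      have "q * to_fract b * x = q * to_fract a"
        by (simp flip: ab add: mult_ac)
      moreover have "q * to_fract b \<in> dom_set" "q * to_fract a \<in> dom_set"
        using q dom_colonD[of q ?X] by simp_all
      ultimately show ?thesis
        by (simp only: dom_colon_pair)
    qed
    \<comment> \<open>For y in I, the element y/b sends b to y and a to yx, both in D. So y/b lies
      in B^{-1}, and multiplying it by p gives an element of D.\<close>
    moreover have "p / to_fract b \<in> dom_colon ?I"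
    proof -
      have "p / to_fract b * y \<in> dom_set" if "y \<in> ?I" for y
      proof -
        have "y / to_fract b * to_fract a = y * x"
          using b by (simp flip: ab)
        then have "y / to_fract b \<in> dom_colon ?B"
          using that b by (simp add: dom_colon_pair) (simp add: dom_colon_def mult.commute)
        then have "y / to_fract b * p \<in> dom_set"
          using p by (rule dom_colonD)
        then show ?thesis
          by (simp add: mult.commute)
      qed
      then show ?thesis
        by (simp add: dom_colon_def[of ?I])
    qed
    ultimately have "q * to_fract b * (p / to_fract b) \<in> ideal_mult ?I (dom_colon ?I)"
      by (rule ideal_mult_mem)
    then show "p * q \<in> ideal_mult ?I (dom_colon ?I)"
      using b by (simp add: mult.commute)
  qed
  then show ?thesis
    using F t_invertible_iff[OF ideal_of_dom_dom_colon_pair I0] by blast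
qed

text \<open>The bound k \<le> n is what keeps the induction going: for i in I, the hypothesis at n +
  1 supplies the hypothesis at n both for wi and for wix, the extra factor x raising the exponent by
  one. So wi and wix are in D, that is wi \<in> I, and stability of I under w gives w \<in>
  D.\<close>

lemma mem_dom_set_if_pow_pair:
  assumes "t_invertible (dom_colon {1, x})"
    and "\<And>p k. p \<in> ideal_pow (dom_colon {1, x}) n \<Longrightarrow> k \<le> n \<Longrightarrow> w * p * x ^ k \<in> dom_set"
  shows "w \<in> dom_set"
  using assms(2)
proof (induction n arbitrary: w)
  case 0
  \<comment> \<open>The zeroth power is D, so p = 1 and k = 0 are admissible.\<close>
  show ?case
    using "0.prems"[of 1 0] by simp
next
  case (Suc n)
  show ?case
  proof (rule t_invertible_stable_multiplier[OF ideal_of_dom_dom_colon_pair assms(1)])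
    fix i assume i: "i \<in> dom_colon {1, x}"
    have *: "w * i * p * x ^ k \<in> dom_set"
      if "p \<in> ideal_pow (dom_colon {1, x}) n" "k \<le> Suc n" for p k
      using Suc.prems[OF ideal_pow_Suc_mem[OF i that(1)] that(2)] by (simp add: mult.assoc)
    have "w * i \<in> dom_set"
      by (rule Suc.IH) (use * in simp)
    moreover have "w * i * x \<in> dom_set"
    proof (rule Suc.IH)
      fix p k assume "p \<in> ideal_pow (dom_colon {1, x}) n" "k \<le> n"
      then show "w * i * x * p * x ^ k \<in> dom_set"
        using *[of p "Suc k"] by (simp add: mult_ac)
    qed
    ultimately show "w * i \<in> dom_colon {1, x}"
      by (simp add: dom_colon_pair)
  qed
qed

text \<open>For y in (D : I^n) and p in I^n, the product (ry) p x^k splits as (r x^k)(yp), with both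
  factors in D; the previous lemma then applies to w = ry.\<close>

lemma mem_v_closure_pow_pair:
  assumes "t_invertible (dom_colon {1, x})" and r: "\<And>k. r * x ^ k \<in> dom_set"
  shows "r \<in> v_closure (ideal_pow (dom_colon {1, x}) n)"
proof (rule v_closureI, rule mem_dom_set_if_pow_pair[OF assms(1)])
  fix y p k assume "y \<in> dom_colon (ideal_pow (dom_colon {1, x}) n)"
    and "p \<in> ideal_pow (dom_colon {1, x}) n"
  then show "r * y * p * x ^ k \<in> dom_set"
    using dom_set_mult[OF r[of k] dom_colonD[of y _ p]] by (simp add: mult_ac)
qed

section \<open>Comparison with the complete integral closure\<close>

lemma dom_colon_subset_complete_integral_closure:
  assumes J: "J \<subseteq> dom_set" and r: "r \<noteq> 0" "\<And>n. n \<ge> 1 \<Longrightarrow> r \<in> v_closure (ideal_pow J n)"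
  shows "dom_colon J \<subseteq> complete_integral_closure"
proof
  fix x assume x: "x \<in> dom_colon J"
  \<comment> \<open>The definition of D'' asks for a multiplier in D itself; the condition at n = 1
    shows that r is one, as J is integral.\<close>
  have "r \<in> dom_set"
    using r(2)[of 1] v_closure_subset_dom_set[OF ideal_pow_subset_dom_set[OF J]] by blast
  then obtain d where d: "r = to_fract d"
    by (auto simp: dom_set_def)
  moreover have "r * x ^ n \<in> dom_set" if "n \<ge> 1" for n
    using r(2)[OF that] power_in_dom_colon_ideal_pow[OF x] by (rule v_closureD)
  ultimately show "x \<in> complete_integral_closure"
    using r(1) by (auto simp: complete_integral_closure_def)
qed

lemma Inter_v_closure_pow_nonzero_iff:
  "(\<Inter>n\<in>{1..}. v_closure (ideal_pow I n)) \<noteq> {0} \<longleftrightarrow>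
    (\<exists>r. r \<noteq> 0 \<and> (\<forall>n\<ge>1. r \<in> v_closure (ideal_pow I n)))"
proof -
  have "0 \<in> v_closure J" for J :: "'a fract set"
    unfolding v_closure_def by (rule fract_mod.subspace_0[OF subspace_dom_colon])
  then have "0 \<in> (\<Inter>n\<in>{1..}. v_closure (ideal_pow I n))"
    by blast
  then show ?thesis
    by blast
qed

theorem proposition2p5:
  assumes "pvmd TYPE('a::idom)"
  shows "let S = {I :: 'a fract set. ideal_of_dom I \<and> t_invertible I \<and>
                    (\<Inter>n\<in>{1..}. v_closure (ideal_pow I n)) \<noteq> {0}}
         in multiplicative_system S \<and> complete_integral_closure = gen_ring_of_fractions S"
proof -
  define S where "S = {I :: 'a fract set. ideal_of_dom I \<and> t_invertible I \<and>
                    (\<Inter>n\<in>{1..}. v_closure (ideal_pow I n)) \<noteq> {0}}"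
  have S_iff: "I \<in> S \<longleftrightarrow> ideal_of_dom I \<and> t_invertible I \<and>
      (\<exists>r. r \<noteq> 0 \<and> (\<forall>n\<ge>1. r \<in> v_closure (ideal_pow I n)))" for I
    unfolding S_def Inter_v_closure_pow_nonzero_iff by simp
  \<comment> \<open>D itself shows that S is nonempty, with 1 as the nonzero common element of the
    v-closures of its powers.\<close>
  have "1 \<in> ideal_pow (dom_set :: 'a fract set) n" for n
    by (induction n) (use ideal_pow_Suc_mem[OF one_in_dom_set] in fastforce)+
  then have "1 \<in> v_closure (ideal_pow (dom_set :: 'a fract set) n)" for n
    using dom_colonD by (intro v_closureI) fastforce
  then have "dom_set \<in> S"
    unfolding S_iff using ideal_of_dom_dom_set t_invertible_dom_set zero_neq_one by metis
  moreover have "ideal_mult I J \<in> S" if "I \<in> S" "J \<in> S" for I J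
  proof -
    obtain r s where "r \<noteq> 0" "\<forall>n\<ge>1. r \<in> v_closure (ideal_pow I n)"
        "s \<noteq> 0" "\<forall>n\<ge>1. s \<in> v_closure (ideal_pow J n)"
      using \<open>I \<in> S\<close> \<open>J \<in> S\<close> unfolding S_iff by blast
    then have "r * s \<noteq> 0 \<and> (\<forall>n\<ge>1. r * s \<in> v_closure (ideal_pow (ideal_mult I J) n))"
      by (simp add: v_closure_ideal_pow_mult)
    then show ?thesis
      using that t_invertible_mult ideal_of_dom_mult unfolding S_iff by blast
  qed
  moreover have "ideal_of_dom I \<and> I \<noteq> {0}" if "I \<in> S" for I
    using that by (auto simp: S_iff t_invertible_def nonzero_fractional_ideal_def)
  ultimately have "multiplicative_system S"
    unfolding multiplicative_system_def by blast
  moreover have "complete_integral_closure = gen_ring_of_fractions S"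
  proof
    show "complete_integral_closure \<subseteq> gen_ring_of_fractions S"
    proof
      fix x :: "'a fract" assume "x \<in> complete_integral_closure"
      then obtain d where d: "d \<noteq> 0" and "\<forall>n\<ge>1. to_fract d * x ^ n \<in> dom_set"
        by (auto simp: complete_integral_closure_def)
      \<comment> \<open>The definition of D'' starts at n = 1; the exponent 0, which
        \<open>mem_v_closure_pow_pair\<close> also uses, is covered by d \<in> D.\<close>
      then have *: "to_fract d * x ^ n \<in> dom_set" for n
        by (cases n) auto
      have t: "t_invertible (dom_colon {1, x})"
        by (rule pvmd_t_invertible_dom_colon_pair[OF assms])
      have "dom_colon {1, x} \<in> S"
        unfolding S_iff using d t ideal_of_dom_dom_colon_pair mem_v_closure_pow_pair[OF t *]
        by (metis to_fract_eq_0_iff)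
      \<comment> \<open>This is (1,x) \<subseteq> (1,x)_v, read at the generator x.\<close>
      moreover have "x \<in> dom_colon (dom_colon {1, x})"
        by (simp add: dom_colon_def mult.commute)
      ultimately show "x \<in> gen_ring_of_fractions S"
        by (auto simp: gen_ring_of_fractions_def)
    qed
    show "gen_ring_of_fractions S \<subseteq> complete_integral_closure"
      unfolding gen_ring_of_fractions_def
    proof (rule UN_least)
      fix J assume "J \<in> S"
      then obtain r where "J \<subseteq> dom_set" "r \<noteq> 0" "\<forall>n\<ge>1. r \<in> v_closure (ideal_pow J n)"
        unfolding S_iff ideal_of_dom_def by blast
      then show "dom_colon J \<subseteq> complete_integral_closure"
        using dom_colon_subset_complete_integral_closure by blast
    qed
  qed
  ultimately show ?thesis
    unfolding S_def Let_def by blast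
qed

end
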